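(* Let $(X,d)$ be an infinite metric space and let $\mathfrak{B}$ be a bornology on $X$ with closed base, $X\notin\mathfrak{B}$. The following equalities hold (where an equality of two selection principles means that $X$ satisfies one if and only if it satisfies the other): (1) $S_{fin}(\Gamma_{\mathfrak{B}^s},\mathcal{O})=U_{fin}(\mathcal{O}_{\mathfrak{B}^s},\mathcal{O})$; (2) $S_{fin}(\mathcal{O}_{\mathfrak{B}^s},\mathcal{O})=S_{fin}(\Gamma_{\mathfrak{B}^s},\mathcal{O})$; (3) $S_{fin}(\mathcal{O}_{\mathfrak{B}^s},\mathcal{O})=U_{fin}(\Gamma_{\mathfrak{B}^s},\mathcal{O})$.
   Context: A bornology $\mathfrak{B}$ on $X$ is a family of subsets of $X$ that is closed under finite unions, hereditary (closed under taking subsets), and covers $X$. A base of $\mathfrak{B}$ is a subfamily of $\mathfrak{B}$ cofinal with respect to inclusion; it is closed if all its members are closed in $X$. For $B\in\mathfrak{B}$ and $\delta>0$, $B^\delta=\bigcup_{x\in B}\{y\in X: d(x,y)<\delta\}$. All open covers of $X$ are assumed to be countably infinite. $\mathcal{O}$ is the collection of all open covers of $X$. An open $\mathfrak{B}^s$-cover of $X$ is an open cover $\mathcal{U}$ with $X\notin\mathcal{U}$ such that for each $B\in\mathfrak{B}$ there are $U\in\mathcal{U}$ and $\delta>0$ with $B^\delta\subseteq U$; $\mathcal{O}_{\mathfrak{B}^s}$ is the collection of all of these. A $\gamma_{\mathfrak{B}^s}$-cover of $X$ is an open cover $\mathcal{U}=\{U_n:n\in\mathbb{N}\}$ which is infinite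 and such that for each $B\in\mathfrak{B}$ there are $n_0\in\mathbb{N}$ and a sequence $\{\delta_n:n\ge n_0\}$ of positive reals with $B^{\delta_n}\subseteq U_n$ for all $n\ge n_0$; $\Gamma_{\mathfrak{B}^s}$ is the collection of all of these. $S_{fin}(\mathcal{A},\mathcal{C})$: for each sequence $\{A_n:n\in\mathbb{N}\}$ of elements of $\mathcal{A}$ there is a sequence $\{B_n:n\in\mathbb{N}\}$ of finite (possibly empty) sets with $B_n\subseteq A_n$ for each $n$ and $\bigcup_{n}B_n\in\mathcal{C}$. $U_{fin}(\mathcal{A},\mathcal{C})$: for each sequence $\{A_n:n\in\mathbb{N}\}$ of elements of $\mathcal{A}$ there is a sequence $\{B_n:n\in\mathbb{N}\}$ of finite (possibly empty) sets with $B_n\subseteq A_n$ for each $n$ and either $\{\bigcup B_n:n\in\mathbb{N}\}\in\mathcal{C}$ or $\bigcup B_n=X$ for some $n$. *)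

theory Defs
  imports "HOL-Analysis.Elementary_Metric_Spaces"
begin

definition bornology :: "'a set set \<Rightarrow> bool" where
  "bornology \<BB> \<longleftrightarrow>
     (\<forall>\<F>. finite \<F> \<longrightarrow> \<F> \<subseteq> \<BB> \<longrightarrow> \<Union>\<F> \<in> \<BB>) \<and>
     (\<forall>B\<in>\<BB>. \<forall>A. A \<subseteq> B \<longrightarrow> A \<in> \<BB>) \<and>
     \<Union>\<BB> = UNIV"

definition bornology_base :: "'a set set \<Rightarrow> 'a set set \<Rightarrow> bool" where
  "bornology_base \<BB> \<BB>0 \<longleftrightarrow> \<BB>0 \<subseteq> \<BB> \<and> (\<forall>B\<in>\<BB>. \<exists>C\<in>\<BB>0. B \<subseteq> C)"

definition has_closed_base :: "'a::topological_space set set \<Rightarrow> bool" where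
  "has_closed_base \<BB> \<longleftrightarrow> (\<exists>\<BB>0. bornology_base \<BB> \<BB>0 \<and> (\<forall>C\<in>\<BB>0. closed C))"

definition enlargement :: "'a::metric_space set \<Rightarrow> real \<Rightarrow> 'a set" where
  "enlargement B \<delta> = (\<Union>x\<in>B. ball x \<delta>)"

text \<open>Standing convention: all open covers are countably infinite families.\<close>

definition open_covers :: "'a::topological_space set set set" where
  "open_covers =
     {\<U>. countable \<U> \<and> infinite \<U> \<and> (\<forall>U\<in>\<U>. open U) \<and> \<Union>\<U> = UNIV}"

definition Bs_covers :: "'a::metric_space set set \<Rightarrow> 'a set set set" where
  "Bs_covers \<BB> =
     {\<U> \<in> open_covers. UNIV \<notin> \<U> \<and>
        (\<forall>B\<in>\<BB>. \<exists>U\<in>\<U>. \<exists>\<delta>>0. enlargement B \<delta> \<subseteq> U)}"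

text \<open>The enumeration of a \<open>\<gamma>\<close>-cover may have repetitions (the family itself is infinite), and
  the whole space is allowed as a member.\<close>

definition gamma_Bs_covers :: "'a::metric_space set set \<Rightarrow> 'a set set set" where
  "gamma_Bs_covers \<BB> =
     {\<U> \<in> open_covers. \<exists>U :: nat \<Rightarrow> 'a set. \<U> = range U \<and>
        (\<forall>B\<in>\<BB>. \<exists>n0. \<exists>\<delta> :: nat \<Rightarrow> real.
           \<forall>n\<ge>n0. \<delta> n > 0 \<and> enlargement B (\<delta> n) \<subseteq> U n)}"

definition S_fin :: "'b set set \<Rightarrow> 'b set set \<Rightarrow> bool" where
  "S_fin \<A> \<C> \<longleftrightarrow>
     (\<forall>A :: nat \<Rightarrow> 'b set. (\<forall>n. A n \<in> \<A>) \<longrightarrow>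
        (\<exists>B. (\<forall>n. finite (B n) \<and> B n \<subseteq> A n) \<and> (\<Union>n. B n) \<in> \<C>))"

definition U_fin :: "'a set set set \<Rightarrow> 'a set set set \<Rightarrow> bool" where
  "U_fin \<A> \<C> \<longleftrightarrow>
     (\<forall>A :: nat \<Rightarrow> 'a set set. (\<forall>n. A n \<in> \<A>) \<longrightarrow>
        (\<exists>B. (\<forall>n. finite (B n) \<and> B n \<subseteq> A n) \<and>
             (range (\<lambda>n. \<Union>(B n)) \<in> \<C> \<or> (\<exists>n. \<Union>(B n) = UNIV))))"

end

theory Submission
  imports Defs
begin

text \<open>
  Under all four selection principles lies one Menger-type property of the families selected from:
  finitely many members can be taken from each cover of a sequence so that together they cover the
  space. This is \<open>finite_selections_cover\<close> below.

  For any class of countably infinite open covers this property is equivalent both to \<^const>\<open>S_fin\<close>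
  and to \<^const>\<open>U_fin\<close> with target \<^const>\<open>open_covers\<close>: the only further demand of these principles
  is that the selected family be infinite, which \<^const>\<open>U_fin\<close> waives as soon as one finite selection
  covers the space. Enlarging the finite selections meets this demand. For \<^const>\<open>S_fin\<close>, add to each
  selection one member of its cover, different ones at different stages. For \<^const>\<open>U_fin\<close>, if no
  finite subfamily covers, the unions of the finite subfamilies that contain a given one form a
  directed family without a largest element, so infinitely many unions are available at every stage
  (\<open>infinitely_many_finite_unions\<close>).

  It remains to compare the two classes of covers. A \<open>\<gamma>\<close>-cover without the member \<^term>\<open>UNIV\<close>
  is a strong \<open>\<BB>\<close>-cover, and if one cover of the sequence has that member, selecting it alone
  suffices. Conversely, the unions of the initial segments of an enumeration of a strong
  \<open>\<BB>\<close>-cover increase, so they form a \<open>\<gamma>\<close>-cover (\<open>initial_unions_gamma_Bs_cover\<close>) unless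
  one of them is the whole space; and each such union comes from a finite selection from the original
  cover.
\<close>

definition finite_selections_cover :: "'a set set set \<Rightarrow> bool" where
  "finite_selections_cover \<A> \<longleftrightarrow>
     (\<forall>A :: nat \<Rightarrow> 'a set set. (\<forall>n. A n \<in> \<A>) \<longrightarrow>
        (\<exists>B. (\<forall>n. finite (B n) \<and> B n \<subseteq> A n) \<and> (\<Union>n. \<Union>(B n)) = UNIV))"

lemma finite_selection_from_one_cover:
  fixes A :: "nat \<Rightarrow> 'a set set"
  assumes "finite \<G>" "\<G> \<subseteq> A n" "\<Union>\<G> = UNIV"
  shows "\<exists>B. (\<forall>n. finite (B n) \<and> B n \<subseteq> A n) \<and> (\<Union>n. \<Union>(B n)) = UNIV"
proof -
  define B where "B m = (if m = n then \<G> else {})" for m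
  have "\<forall>m. finite (B m) \<and> B m \<subseteq> A m"
    using assms(1,2) by (simp add: B_def)
  moreover have "\<Union>\<G> \<subseteq> (\<Union>m. \<Union>(B m))"
    unfolding B_def by (rule order_trans[OF _ UN_upper[of n]]) simp_all
  then have "(\<Union>m. \<Union>(B m)) = UNIV"
    by (simp only: assms(3) top.extremum_unique)
  ultimately show ?thesis
    by (intro exI[of _ B] conjI)
qed

lemma finite_selections_coverD:
  fixes A :: "nat \<Rightarrow> 'a set set"
  assumes "finite_selections_cover \<A>" and "\<forall>n. A n \<in> \<A>"
  shows "\<exists>B. (\<forall>n. finite (B n) \<and> B n \<subseteq> A n) \<and> (\<Union>n. \<Union>(B n)) = UNIV"
  using assms(1)[unfolded finite_selections_cover_def, THEN spec[of _ A]] assms(2) by simp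

lemma injective_choice_from_infinite_sets:
  fixes S :: "nat \<Rightarrow> 'b set"
  assumes "\<forall>n. infinite (S n)"
  shows "\<exists>f. inj f \<and> (\<forall>n. f n \<in> S n)"
proof -
  have "\<exists>f. \<forall>n. f n \<in> S n - f ` {..<n}"
  proof (rule dependent_wf_choice[of less_than "\<lambda>f n r. r \<in> S n - f ` {..<n}"])
    fix f :: "nat \<Rightarrow> 'b" and n
    have "infinite (S n - f ` {..<n})"
      using assms by simp
    then show "\<exists>r. r \<in> S n - f ` {..<n}"
      using infinite_imp_nonempty by blast
  next
    fix f g :: "nat \<Rightarrow> 'b" and n r
    assume "\<And>m. (m, n) \<in> less_than \<Longrightarrow> f m = g m"
    then have "f ` {..<n} = g ` {..<n}"
      by (intro image_cong) auto
    then show "(r \<in> S n - f ` {..<n}) = (r \<in> S n - g ` {..<n})"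
      by simp
  qed simp
  then obtain f where f: "\<And>n. f n \<in> S n - f ` {..<n}"
    by blast
  have "inj f"
  proof (rule linorder_injI)
    fix m n :: nat
    assume "m < n"
    then show "f m \<noteq> f n"
      using f[of n] by (metis DiffD2 image_eqI lessThan_iff)
  qed
  with f show ?thesis
    by blast
qed

text \<open>
  These unions are closed under binary unions, so if there were only finitely many of them, their total
  union would be one of them; but that is the whole space. The subfamily \<open>\<F>\<close> allows a
  selection that was made earlier to be kept.
\<close>
lemma infinitely_many_finite_unions:
  assumes "\<Union>\<U> = UNIV" and "finite \<F>" "\<F> \<subseteq> \<U>"
    and no_finite_subcover: "\<And>\<G>. finite \<G> \<Longrightarrow> \<G> \<subseteq> \<U> \<Longrightarrow> \<Union>\<G> \<noteq> UNIV"
  shows "infinite {\<Union>\<G> | \<G>. finite \<G> \<and> \<F> \<subseteq> \<G> \<and> \<G> \<subseteq> \<U>}" (is "infinite ?S")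
proof
  assume "finite ?S"
  have "\<Union>?S \<in> ?S"
  proof (rule finite_Sup_in[OF \<open>finite ?S\<close>])
    show "?S \<noteq> {}"
      using assms(2,3) by blast
  next
    fix V W
    assume "V \<in> ?S" "W \<in> ?S"
    then obtain \<G> \<H> where "V = \<Union>\<G>" "finite \<G>" "\<F> \<subseteq> \<G>" "\<G> \<subseteq> \<U>"
      and "W = \<Union>\<H>" "finite \<H>" "\<F> \<subseteq> \<H>" "\<H> \<subseteq> \<U>"
      by blast
    then have "sup V W = \<Union>(\<G> \<union> \<H>)" "finite (\<G> \<union> \<H>)" "\<F> \<subseteq> \<G> \<union> \<H>" "\<G> \<union> \<H> \<subseteq> \<U>"
      by auto
    then show "sup V W \<in> ?S"
      by blast
  qed
  moreover have "UNIV = \<Union>?S"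
  proof (rule UNIV_eq_I)
    fix x
    obtain U where "x \<in> U" "U \<in> \<U>"
      using assms(1) by blast
    then have "finite (insert U \<F>) \<and> \<F> \<subseteq> insert U \<F> \<and> insert U \<F> \<subseteq> \<U>"
      using assms(2,3) by auto
    then have "\<Union>(insert U \<F>) \<in> ?S"
      by blast
    moreover have "x \<in> \<Union>(insert U \<F>)"
      using \<open>x \<in> U\<close> by simp
    ultimately show "x \<in> \<Union>?S"
      by (rule UnionI)
  qed
  ultimately have "UNIV \<in> ?S"
    by simp
  then obtain \<G> where "UNIV = \<Union>\<G>" "finite \<G>" "\<G> \<subseteq> \<U>"
    by blast
  then show False
    using no_finite_subcover[of \<G>] by simp
qed

text \<open>
  Infinity of the selected family is achieved by an injective choice of one additional member from
  every cover.
\<close>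
lemma S_fin_open_covers_iff:
  assumes "\<A> \<subseteq> open_covers"
  shows "S_fin \<A> open_covers \<longleftrightarrow> finite_selections_cover \<A>"
proof
  assume S_fin: "S_fin \<A> open_covers"
  show "finite_selections_cover \<A>"
    unfolding finite_selections_cover_def
  proof (intro allI impI)
    fix A :: "nat \<Rightarrow> 'a set set"
    assume "\<forall>n. A n \<in> \<A>"
    then obtain B where B: "\<forall>n. finite (B n) \<and> B n \<subseteq> A n" and "(\<Union>n. B n) \<in> open_covers"
      using S_fin unfolding S_fin_def by blast
    then have "\<Union>(\<Union>n. B n) = UNIV"
      by (simp add: open_covers_def)
    then have "(\<Union>n. \<Union>(B n)) = UNIV"
      by blast
    with B show "\<exists>B. (\<forall>n. finite (B n) \<and> B n \<subseteq> A n) \<and> (\<Union>n. \<Union>(B n)) = UNIV"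
      by (intro exI[of _ B] conjI)
  qed
next
  assume cover: "finite_selections_cover \<A>"
  show "S_fin \<A> open_covers"
    unfolding S_fin_def
  proof (intro allI impI)
    fix A :: "nat \<Rightarrow> 'a set set"
    assume A: "\<forall>n. A n \<in> \<A>"
    obtain B where B: "\<forall>n. finite (B n) \<and> B n \<subseteq> A n" "(\<Union>n. \<Union>(B n)) = UNIV"
      using finite_selections_coverD[OF cover A] by (elim exE conjE)
    have A_open_cover: "A n \<in> open_covers" for n
      using A assms by blast
    then have "\<forall>n. infinite (A n)"
      by (simp add: open_covers_def)
    from injective_choice_from_infinite_sets[OF this]
    obtain f where f: "inj f" "\<forall>n. f n \<in> A n"
      by (elim exE conjE)
    define C where "C n = insert (f n) (B n)" for n
    have C: "finite (C n)" "C n \<subseteq> A n" for n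
      using B(1) f(2) by (auto simp: C_def)
    have "infinite (range f)"
      using f(1) by (simp add: finite_image_iff)
    moreover have "range f \<subseteq> (\<Union>n. C n)"
      by (auto simp: C_def)
    ultimately have "infinite (\<Union>n. C n)"
      using infinite_super by blast
    moreover have "countable (\<Union>n. C n)"
      using C(1) by (simp add: countable_finite)
    moreover have "open U" if "U \<in> (\<Union>n. C n)" for U
      using that C(2) A_open_cover by (auto simp: open_covers_def)
    moreover have "\<Union>(\<Union>n. C n) = UNIV"
      using B(2) by (auto simp: C_def)
    ultimately have "(\<Union>n. C n) \<in> open_covers"
      by (simp add: open_covers_def)
    with C show "\<exists>B. (\<forall>n. finite (B n) \<and> B n \<subseteq> A n) \<and> (\<Union>n. B n) \<in> open_covers"
      by (intro exI[of _ C] conjI allI)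
  qed
qed

text \<open>
  Here pairwise different members would not do, since different finite subfamilies may have the same
  union; the unions themselves have to be chosen injectively.
\<close>
lemma U_fin_open_covers_iff:
  assumes "\<A> \<subseteq> open_covers"
  shows "U_fin \<A> open_covers \<longleftrightarrow> finite_selections_cover \<A>"
proof
  assume U_fin: "U_fin \<A> open_covers"
  show "finite_selections_cover \<A>"
    unfolding finite_selections_cover_def
  proof (intro allI impI)
    fix A :: "nat \<Rightarrow> 'a set set"
    assume A: "\<forall>n. A n \<in> \<A>"
    obtain B where B: "\<forall>n. finite (B n) \<and> B n \<subseteq> A n"
      and "range (\<lambda>n. \<Union>(B n)) \<in> open_covers \<or> (\<exists>n. \<Union>(B n) = UNIV)"
      using U_fin[unfolded U_fin_def, THEN spec[of _ A], THEN mp, OF A] by (elim exE conjE)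
    then have "(\<Union>n. \<Union>(B n)) = UNIV"
    proof (elim disjE exE)
      fix n
      assume "\<Union>(B n) = UNIV"
      moreover have "\<Union>(B n) \<subseteq> (\<Union>n. \<Union>(B n))"
        by (rule UN_upper) simp
      ultimately show ?thesis
        by (simp only: top.extremum_unique)
    qed (simp add: open_covers_def)
    with B show "\<exists>B. (\<forall>n. finite (B n) \<and> B n \<subseteq> A n) \<and> (\<Union>n. \<Union>(B n)) = UNIV"
      by (intro exI[of _ B] conjI)
  qed
next
  assume cover: "finite_selections_cover \<A>"
  show "U_fin \<A> open_covers"
    unfolding U_fin_def
  proof (intro allI impI)
    fix A :: "nat \<Rightarrow> 'a set set"
    assume A: "\<forall>n. A n \<in> \<A>"
    have A_open_cover: "A n \<in> open_covers" for n
      using A assms by blast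
    show "\<exists>B. (\<forall>n. finite (B n) \<and> B n \<subseteq> A n) \<and>
             (range (\<lambda>n. \<Union>(B n)) \<in> open_covers \<or> (\<exists>n. \<Union>(B n) = UNIV))"
    proof (cases "\<exists>n \<G>. finite \<G> \<and> \<G> \<subseteq> A n \<and> \<Union>\<G> = UNIV")
      case True
      then obtain n \<G> where "finite \<G>" "\<G> \<subseteq> A n" "\<Union>\<G> = UNIV"
        by blast
      then show ?thesis
        by (intro exI[of _ "\<lambda>m. if m = n then \<G> else {}"]) auto
    next
      case False
      obtain B where B: "\<forall>n. finite (B n) \<and> B n \<subseteq> A n" "(\<Union>n. \<Union>(B n)) = UNIV"
        using finite_selections_coverD[OF cover A] by (elim exE conjE)
      \<comment> \<open>Any choice of sets from the \<open>S n\<close> still covers, because each contains the union of \<open>B n\<close>;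
        it remains to choose them pairwise different.\<close>
      define S where "S n = {\<Union>\<G> | \<G>. finite \<G> \<and> B n \<subseteq> \<G> \<and> \<G> \<subseteq> A n}" for n
      have "\<forall>n. infinite (S n)"
        unfolding S_def
        using A_open_cover B(1) False
        by (intro allI infinitely_many_finite_unions) (auto simp: open_covers_def)
      from injective_choice_from_infinite_sets[OF this]
      obtain f where f: "inj f" "\<forall>n. f n \<in> S n"
        by (elim exE conjE)
      then have "\<forall>n. \<exists>\<G>. f n = \<Union>\<G> \<and> finite \<G> \<and> B n \<subseteq> \<G> \<and> \<G> \<subseteq> A n"
        by (simp add: S_def)
      then have "\<exists>C. \<forall>n. f n = \<Union>(C n) \<and> finite (C n) \<and> B n \<subseteq> C n \<and> C n \<subseteq> A n"
        by (rule choice)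
      then obtain C where "\<forall>n. f n = \<Union>(C n) \<and> finite (C n) \<and> B n \<subseteq> C n \<and> C n \<subseteq> A n"
        by (rule exE)
      then have C: "f n = \<Union>(C n)" "finite (C n)" "B n \<subseteq> C n" "C n \<subseteq> A n" for n
        by simp_all
      have "open (f n)" for n
      proof -
        have "\<forall>U\<in>C n. open U"
          using C(4)[of n] A_open_cover[of n] by (auto simp: open_covers_def)
        then show ?thesis
          by (simp only: C(1) open_Union)
      qed
      moreover have "infinite (range f)"
        using f(1) by (simp add: finite_image_iff)
      moreover have "(\<Union>n. \<Union>(B n)) \<subseteq> \<Union>(range f)"
        unfolding C(1) using C(3) by blast
      then have "\<Union>(range f) = UNIV"
        by (simp only: B(2) top.extremum_unique)
      ultimately have "range f \<in> open_covers"
        by (auto simp: open_covers_def)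
      then have "range (\<lambda>n. \<Union>(C n)) \<in> open_covers"
        by (simp only: C(1)[abs_def])
      then show ?thesis
        using C(2,4) by (intro exI[of _ C] conjI allI disjI1)
    qed
  qed
qed

lemma gamma_Bs_cover_without_UNIV_is_Bs_cover:
  assumes "\<U> \<in> gamma_Bs_covers \<BB>" and "UNIV \<notin> \<U>"
  shows "\<U> \<in> Bs_covers \<BB>"
proof -
  obtain U where U: "\<U> \<in> open_covers" "\<U> = range U"
    "\<forall>B\<in>\<BB>. \<exists>n0. \<exists>\<delta> :: nat \<Rightarrow> real. \<forall>n\<ge>n0. \<delta> n > 0 \<and> enlargement B (\<delta> n) \<subseteq> U n"
    using assms(1) unfolding gamma_Bs_covers_def by auto
  have "\<exists>V\<in>\<U>. \<exists>\<epsilon>>0. enlargement B \<epsilon> \<subseteq> V" if "B \<in> \<BB>" for B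
  proof -
    obtain n0 and \<delta> :: "nat \<Rightarrow> real" where "\<forall>n\<ge>n0. \<delta> n > 0 \<and> enlargement B (\<delta> n) \<subseteq> U n"
      using U(3)[THEN bspec, OF \<open>B \<in> \<BB>\<close>] by (elim exE)
    then have "\<delta> n0 > 0" "enlargement B (\<delta> n0) \<subseteq> U n0"
      by simp_all
    then show ?thesis
      unfolding U(2) by blast
  qed
  then show ?thesis
    using U(1) assms(2) by (simp add: Bs_covers_def)
qed

text \<open>
  A radius that works for one member works for every later union, which gives the \<open>\<gamma>\<close>-condition.
  The family is infinite because a finite chain contains its union, which is the whole space.
\<close>
lemma initial_unions_gamma_Bs_cover:
  fixes U :: "nat \<Rightarrow> 'a::metric_space set"
  assumes "range U \<in> Bs_covers \<BB>" and "\<And>k. (\<Union>j\<le>k. U j) \<noteq> UNIV"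
  shows "range (\<lambda>k. \<Union>j\<le>k. U j) \<in> gamma_Bs_covers \<BB>"
proof -
  define V where "V k = (\<Union>j\<le>k. U j)" for k
  have U: "\<And>k. open (U k)" "\<Union>(range U) = UNIV"
    using assms(1) by (auto simp: Bs_covers_def open_covers_def)
  have "\<Union>(range U) \<subseteq> \<Union>(range V)"
    unfolding V_def by blast
  then have V_covers: "\<Union>(range V) = UNIV"
    by (simp only: U(2) top.extremum_unique)
  have "infinite (range V)"
  proof
    assume "finite (range V)"
    then have "\<Union>(range V) \<in> range V"
    proof (rule finite_Sup_in)
      fix W W'
      assume "W \<in> range V" "W' \<in> range V"
      then obtain i j where "W = V i" "W' = V j"
        by blast
      then have "sup W W' = V (max i j)"
        by (auto simp: V_def le_max_iff_disj)
      then show "sup W W' \<in> range V"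
        by blast
    qed simp
    then show False
      using V_covers assms(2) by (auto simp: V_def)
  qed
  then have "range V \<in> open_covers"
    using U(1) V_covers by (auto simp: open_covers_def V_def)
  moreover have "\<exists>n0. \<exists>\<delta> :: nat \<Rightarrow> real. \<forall>n\<ge>n0. \<delta> n > 0 \<and> enlargement B (\<delta> n) \<subseteq> V n"
    if "B \<in> \<BB>" for B
  proof -
    have "\<exists>j \<epsilon>. \<epsilon> > 0 \<and> enlargement B \<epsilon> \<subseteq> U j"
      using assms(1) that by (simp add: Bs_covers_def)
    then obtain j \<epsilon> where "\<epsilon> > 0" "enlargement B \<epsilon> \<subseteq> U j"
      by (elim exE conjE)
    then have "\<forall>n\<ge>j. \<epsilon> > 0 \<and> enlargement B \<epsilon> \<subseteq> V n"
      by (auto simp: V_def)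
    then show ?thesis
      by (intro exI[of _ j] exI[of _ "\<lambda>_. \<epsilon>"])
  qed
  ultimately have "range V \<in> gamma_Bs_covers \<BB>"
    unfolding gamma_Bs_covers_def by (intro CollectI conjI exI[of _ V] refl ballI)
  then show ?thesis
    by (simp add: V_def[abs_def])
qed

text \<open>
  In both directions the covers of one class are turned into covers of the other. This can fail
  only when finitely many members of a single cover suffice: a \<open>\<gamma>\<close>-cover may contain the whole space,
  and the initial unions of a strong \<open>\<BB>\<close>-cover may become constant.
\<close>
lemma finite_selections_cover_Bs_iff_gamma:
  fixes \<BB> :: "'a::metric_space set set"
  shows "finite_selections_cover (Bs_covers \<BB>) \<longleftrightarrow> finite_selections_cover (gamma_Bs_covers \<BB>)"
proof
  assume Bs: "finite_selections_cover (Bs_covers \<BB>)"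
  show "finite_selections_cover (gamma_Bs_covers \<BB>)"
    unfolding finite_selections_cover_def
  proof (intro allI impI)
    fix A :: "nat \<Rightarrow> 'a set set"
    assume A: "\<forall>n. A n \<in> gamma_Bs_covers \<BB>"
    show "\<exists>B. (\<forall>n. finite (B n) \<and> B n \<subseteq> A n) \<and> (\<Union>n. \<Union>(B n)) = UNIV"
    proof (cases "\<exists>n. UNIV \<in> A n")
      case True
      then obtain n where "UNIV \<in> A n"
        by blast
      then show ?thesis
        by (intro finite_selection_from_one_cover[of "{UNIV}"]) auto
    next
      case False
      then have "\<forall>n. A n \<in> Bs_covers \<BB>"
        using A gamma_Bs_cover_without_UNIV_is_Bs_cover by blast
      then show ?thesis
        by (rule finite_selections_coverD[OF Bs])
    qed
  qed
next
  assume gamma: "finite_selections_cover (gamma_Bs_covers \<BB>)"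
  show "finite_selections_cover (Bs_covers \<BB>)"
    unfolding finite_selections_cover_def
  proof (intro allI impI)
    fix A :: "nat \<Rightarrow> 'a set set"
    assume A: "\<forall>n. A n \<in> Bs_covers \<BB>"
    define U where "U n = from_nat_into (A n)" for n
    have range_U: "range (U n) = A n" for n
    proof -
      have "countable (A n)" "infinite (A n)"
        using A by (auto simp: Bs_covers_def open_covers_def)
      then show ?thesis
        unfolding U_def by (intro range_from_nat_into) auto
    qed
    define V where "V n k = (\<Union>j\<le>k. U n j)" for n k
    show "\<exists>B. (\<forall>n. finite (B n) \<and> B n \<subseteq> A n) \<and> (\<Union>n. \<Union>(B n)) = UNIV"
    proof (cases "\<exists>n k. V n k = UNIV")
      case True
      then obtain n k where "V n k = UNIV"
        by blast
      moreover have "U n ` {..k} \<subseteq> A n"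
        using range_U[of n] by blast
      ultimately show ?thesis
        by (intro finite_selection_from_one_cover[of "U n ` {..k}" A n]) (simp_all add: V_def)
    next
      case False
      have "\<forall>n. range (V n) \<in> gamma_Bs_covers \<BB>"
      proof
        fix n
        show "range (V n) \<in> gamma_Bs_covers \<BB>"
          using initial_unions_gamma_Bs_cover[of "U n" \<BB>] A range_U[of n] False
          by (simp add: V_def[abs_def])
      qed
      from finite_selections_coverD[OF gamma this]
      obtain C where C: "\<forall>n. finite (C n) \<and> C n \<subseteq> range (V n)" "(\<Union>n. \<Union>(C n)) = UNIV"
        by (elim exE conjE)
      have "\<forall>n. \<exists>K. finite K \<and> C n = V n ` K"
        using C(1) finite_subset_image by metis
      then have "\<exists>K. \<forall>n. finite (K n) \<and> C n = V n ` K n"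
        by (rule choice)
      then obtain K where "\<forall>n. finite (K n) \<and> C n = V n ` K n"
        by (rule exE)
      then have K: "finite (K n)" "C n = V n ` K n" for n
        by simp_all
      \<comment> \<open>Replace each selected initial union by the members that it is the union of.\<close>
      define D where "D n = (\<Union>k\<in>K n. U n ` {..k})" for n
      have "finite (D n)" "D n \<subseteq> A n" for n
        using K(1) by (auto simp: D_def simp flip: range_U)
      moreover have "\<Union>(D n) = \<Union>(C n)" for n
        by (auto simp: D_def K(2) V_def)
      then have "(\<Union>n. \<Union>(D n)) = UNIV"
        using C(2) by simp
      ultimately show ?thesis
        by (intro exI[of _ D] conjI allI)
    qed
  qed
qed

theorem theorem3p3:
  fixes \<BB> :: "'a::metric_space set set"
  assumes "infinite (UNIV :: 'a set)"
    and "bornology \<BB>"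
    and "has_closed_base \<BB>"
    and "UNIV \<notin> \<BB>"
  shows "(S_fin (gamma_Bs_covers \<BB>) open_covers \<longleftrightarrow> U_fin (Bs_covers \<BB>) open_covers) \<and>
         (S_fin (Bs_covers \<BB>) open_covers \<longleftrightarrow> S_fin (gamma_Bs_covers \<BB>) open_covers) \<and>
         (S_fin (Bs_covers \<BB>) open_covers \<longleftrightarrow> U_fin (gamma_Bs_covers \<BB>) open_covers)"
proof -
  have "Bs_covers \<BB> \<subseteq> open_covers" "gamma_Bs_covers \<BB> \<subseteq> open_covers"
    by (auto simp: Bs_covers_def gamma_Bs_covers_def)
  then show ?thesis
    by (simp add: S_fin_open_covers_iff U_fin_open_covers_iff finite_selections_cover_Bs_iff_gamma)
qed

end
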